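(* Let $1\le p\le n$, let $A_1,\dots,A_N$ be real symmetric $n\times n$ matrices, let $Y\in\mathrm{St}(p,n)$ and let $Y_\perp\in\mathbb R^{n\times(n-p)}$ satisfy $Y^TY_\perp=0$ and $Y_\perp^TY_\perp=I_{n-p}$. Put $Z_l=Y^TA_lY$, $Z_l^{\perp}=Y^TA_lY_\perp$, $Z_l^{\perp\perp}=Y_\perp^TA_lY_\perp$ for $l=1,\dots,N$, and let $K:=\dim \mathrm{St}(p,n)=p(p-1)/2+p(n-p)$. Let $H$ be the linear transformation on $\mathbb R^K$ which acts on $\begin{pmatrix}\operatorname{veck}(B)\\ \operatorname{vec}(C)\end{pmatrix}$, for $B\in\mathrm{Skew}(p)$ and $C\in\mathbb R^{(n-p)\times p}$, by $$H\begin{pmatrix}\operatorname{veck}(B)\\ \operatorname{vec}(C)\end{pmatrix}=\begin{pmatrix}\operatorname{veck}(B_H)\\ \operatorname{vec}(C_H)\end{pmatrix},$$ where $$B_H=-4\sum_{l=1}^N\operatorname{skew}\Bigl((Z_lB+Z_l^{\perp}C)\operatorname{diag}(Z_l)+2Z_l\operatorname{diag}(Z_lB+Z_l^{\perp}C)-B\operatorname{sym}(Z_l\operatorname{diag}(Z_l))\Bigr),$$ $$C_H=-4\sum_{l=1}^N\Bigl(((Z_l^{\perp})^TB+Z_l^{\perp\perp}C)\operatorname{diag}(Z_l)+2(Z_l^{\perp})^T\operatorname{diag}(Z_lB+Z_l^{\perp}C)-C\operatorname{sym}(Z_l\operatorname{diag}(Z_l))\Bigr).$$ Then the representation matrix $H_A$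 of $H$ is $$H_A=\begin{pmatrix}H_{11}&H_{12}\\H_{21}&H_{22}\end{pmatrix},$$ where $$H_{11}=-2D_p^T\sum_{l=1}^N\Bigl(\operatorname{diag}(Z_l)\otimes Z_l+2(I_p\otimes Z_l)\Delta_p(I_p\otimes Z_l)-\operatorname{sym}(Z_l\operatorname{diag}(Z_l))\otimes I_p\Bigr)D_p,$$ $$H_{12}=-2D_p^T\sum_{l=1}^N\Bigl(\operatorname{diag}(Z_l)\otimes Z_l^{\perp}+2(I_p\otimes Z_l)\Delta_p(I_p\otimes Z_l^{\perp})\Bigr),$$ $$H_{21}=-4\sum_{l=1}^N\Bigl(\operatorname{diag}(Z_l)\otimes (Z_l^{\perp})^T+2(I_p\otimes (Z_l^{\perp})^T)\Delta_p(I_p\otimes Z_l)\Bigr)D_p,$$ $$H_{22}=-4\sum_{l=1}^N\Bigl(\operatorname{diag}(Z_l)\otimes Z_l^{\perp\perp}+2(I_p\otimes (Z_l^{\perp})^T)\Delta_p(I_p\otimes Z_l^{\perp})-\operatorname{sym}(Z_l\operatorname{diag}(Z_l))\otimes I_{n-p}\Bigr).$$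
   Context: $\mathrm{St}(p,n)=\{Y\in\mathbb R^{n\times p}: Y^TY=I_p\}$ is the Stiefel manifold; $\mathrm{Skew}(p)$ is the set of real skew-symmetric $p\times p$ matrices. For a square matrix $W=(w_{ij})$: $\operatorname{sym}(W)=(W+W^T)/2$, $\operatorname{skew}(W)=(W-W^T)/2$, and $\operatorname{diag}(W)$ is the diagonal matrix with the same diagonal as $W$ (entries $w_{ij}\delta_{ij}$). $\otimes$ is the Kronecker product. $\operatorname{vec}(W)$ stacks the columns of $W$ vertically. For a skew-symmetric $m\times m$ matrix $S=(s_{ij})$, $\operatorname{veck}(S)=(s_{21},\dots,s_{m1},s_{32},\dots,s_{m2},\dots,s_{m,m-1})^T\in\mathbb R^{m(m-1)/2}$ stacks the columns of the strictly lower triangular part of $S$. $E^{(a\times b)}_{ij}$ is the $a\times b$ matrix with $(i,j)$ entry $1$ and all other entries $0$. $\Delta_m=\sum_{i=1}^m E^{(m\times m)}_{ii}\otimes E^{(m\times m)}_{ii}$. $D_m$ is the $m^2\times m(m-1)/2$ matrix $$D_m=\sum_{m\ge i>j\ge1}\Bigl(E^{(m^2\times m(m-1)/2)}_{m(j-1)+i,\ j(m-(j+1)/2)-m+i}-E^{(m^2\times m(m-1)/2)}_{m(i-1)+j,\ j(m-(j+1)/2)-m+i}\Bigr),$$ so that $\operatorname{vec}(S)=D_m\operatorname{veck}(S)$ for every skew-symmetric $m\times m$ matrix $S$. If $p=n$, $Y_\perp$ and $C$ are empty and only the block $H_{11}$ is present. *)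

theory Defs
  imports "Jordan_Normal_Form.VS_Connect"
begin

text \<open>Matrices of the library are indexed from 0, and may have no rows or no columns. The latter
  covers the square case \<open>p = n\<close> (no \<open>C\<close>, empty blocks) and \<open>p = 1\<close> (\<open>veck B\<close> empty).\<close>

definition stiefel :: "nat \<Rightarrow> nat \<Rightarrow> real mat set" where
  "stiefel p n = {Y \<in> carrier_mat n p. Y\<^sup>T * Y = 1\<^sub>m p}"

definition Skew :: "nat \<Rightarrow> real mat set" where
  "Skew m = {S \<in> carrier_mat m m. S\<^sup>T = - S}"

definition sym_part :: "real mat \<Rightarrow> real mat" where
  "sym_part W = (1/2) \<cdot>\<^sub>m (W + W\<^sup>T)"

definition skew_part :: "real mat \<Rightarrow> real mat" where
  "skew_part W = (1/2) \<cdot>\<^sub>m (W - W\<^sup>T)"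

definition diag_part :: "real mat \<Rightarrow> real mat" where
  "diag_part W = mat (dim_row W) (dim_col W) (\<lambda>(i, j). if i = j then W $$ (i, j) else 0)"

definition kronecker :: "real mat \<Rightarrow> real mat \<Rightarrow> real mat" (infixl \<open>\<otimes>\<^sub>K\<close> 70) where
  "A \<otimes>\<^sub>K B = mat (dim_row A * dim_row B) (dim_col A * dim_col B)
     (\<lambda>(i, j). A $$ (i div dim_row B, j div dim_col B) * B $$ (i mod dim_row B, j mod dim_col B))"

definition vec_op :: "real mat \<Rightarrow> real vec" where
  "vec_op W = vec (dim_row W * dim_col W) (\<lambda>k. W $$ (k mod dim_row W, k div dim_row W))"

definition veck :: "real mat \<Rightarrow> real vec" where
  "veck S = vec_of_list
     (concat (map (\<lambda>j. map (\<lambda>i. S $$ (i, j)) [Suc j..<dim_row S]) [0..<dim_col S]))"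

text \<open>Matrices of different sizes share a type without a common zero, so a finite sum of
  \<open>r \<times> c\<close> matrices is taken in the module of these matrices.\<close>

abbreviation msum :: "nat \<Rightarrow> nat \<Rightarrow> ('i \<Rightarrow> real mat) \<Rightarrow> 'i set \<Rightarrow> real mat" where
  "msum r c F I \<equiv> finsum (module_mat TYPE(real) r c) F I"

text \<open>The position \<open>(i, j)\<close> in \<open>E_mat a b i j\<close> is counted from 1, so that the
  index formulas below are the usual ones.\<close>

definition E_mat :: "nat \<Rightarrow> nat \<Rightarrow> nat \<Rightarrow> nat \<Rightarrow> real mat" where
  "E_mat a b i j = mat a b (\<lambda>(k, l). if Suc k = i \<and> Suc l = j then 1 else 0)"

definition Delta_mat :: "nat \<Rightarrow> real mat" where
  "Delta_mat m = msum (m * m) (m * m) (\<lambda>i. E_mat m m i i \<otimes>\<^sub>K E_mat m m i i) {1..m}"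

text \<open>The number \<open>j (m - (j + 1)/2) - m + i\<close> is written as
  \<open>j m + i - j (j + 1)/2 - m\<close>: in this order the subtractions on \<open>nat\<close> do not
  truncate for \<open>1 \<le> j < i \<le> m\<close>.\<close>

definition D_mat :: "nat \<Rightarrow> real mat" where
  "D_mat m = msum (m\<^sup>2) (m * (m - 1) div 2)
     (\<lambda>(i, j). let c = j * m + i - j * (j + 1) div 2 - m in
        E_mat (m\<^sup>2) (m * (m - 1) div 2) (m * (j - 1) + i) c
        - E_mat (m\<^sup>2) (m * (m - 1) div 2) (m * (i - 1) + j) c)
     {(i, j). 1 \<le> j \<and> j < i \<and> i \<le> m}"

definition linear_on :: "nat \<Rightarrow> (real vec \<Rightarrow> real vec) \<Rightarrow> bool" where
  "linear_on K H \<longleftrightarrow>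
     linear_map class_ring (module_vec TYPE(real) K) (module_vec TYPE(real) K) H"

definition representation_matrix :: "nat \<Rightarrow> (real vec \<Rightarrow> real vec) \<Rightarrow> real mat" where
  "representation_matrix K H = mat_of_cols K (map (\<lambda>j. H (unit_vec K j)) [0..<K])"


text \<open>Every vector of \<open>\<real>\<^sup>K\<close> is uniquely of the form \<open>veck B @\<^sub>v vec_op C\<close>, so that prescribing
  the values at these vectors determines a map on \<open>\<real>\<^sup>K\<close>.\<close>

definition lower_pos :: "nat \<Rightarrow> (nat \<times> nat) list" where
  "lower_pos m = concat (map (\<lambda>j. map (\<lambda>i. (i, j)) [Suc j..<m]) [0..<m])"

lemma set_lower_pos: "set (lower_pos m) = {(i, j). j < i \<and> i < m}"
  by (force simp: lower_pos_def)

lemma distinct_lower_pos: "distinct (lower_pos m)"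
proof -
  have "distinct (concat (map (\<lambda>j. map (\<lambda>i. (i, j)) [Suc j..<m]) [0..<k]))" for k
    by (induction k) (auto simp: distinct_map inj_on_def)
  then show ?thesis by (simp add: lower_pos_def)
qed

lemma length_lower_pos: "length (lower_pos m) = m * (m - 1) div 2"
proof -
  have "k \<le> m \<Longrightarrow> 2 * length (concat (map (\<lambda>j. map (\<lambda>i. (i, j)) [Suc j..<m]) [0..<k])) + k * (k + 1)
      = 2 * k * m" for k
  proof (induction k)
    case (Suc k)
    then obtain d where "m = Suc k + d" by (metis le_Suc_ex)
    with Suc show ?case by (simp add: algebra_simps)
  qed simp
  from this[of m] have "2 * length (lower_pos m) + m * (m + 1) = 2 * m * m"
    by (simp add: lower_pos_def)
  then have "2 * length (lower_pos m) = m * (m - 1)"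
    by (cases m) (auto simp: algebra_simps)
  then show ?thesis by simp
qed

lemma veck_eq_lower_pos:
  assumes "S \<in> carrier_mat m m"
  shows "veck S = vec_of_list (map (\<lambda>ij. S $$ ij) (lower_pos m))"
  using assms by (auto simp: veck_def lower_pos_def map_concat comp_def)

lemma ex_skew_veck:
  assumes "v \<in> carrier_vec (m * (m - 1) div 2)"
  shows "\<exists>S\<in>Skew m. veck S = v"
proof -
  let ?ps = "lower_pos m"
  define g where "g = the_inv_into {..<length ?ps} ((!) ?ps)"
  have inj: "inj_on ((!) ?ps) {..<length ?ps}"
    using distinct_lower_pos by (auto simp: inj_on_def nth_eq_iff_index_eq)
  have g: "g (?ps ! k) = k" if "k < length ?ps" for k
    unfolding g_def using the_inv_into_f_f[OF inj] that by simp
  define S where "S = mat m m (\<lambda>(i, j). if j < i then v $ g (i, j)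
     else if i < j then - v $ g (j, i) else 0)"
  have S: "S \<in> carrier_mat m m" by (simp add: S_def)
  have "S \<in> Skew m"
    by (auto simp: Skew_def S_def intro!: eq_matI)
  moreover have "veck S = v"
  proof (rule eq_vecI)
    show "dim_vec (veck S) = dim_vec v"
      using assms by (simp add: veck_eq_lower_pos[OF S] length_lower_pos)
    fix k assume "k < dim_vec v"
    then have k: "k < length ?ps" using assms by (simp add: length_lower_pos)
    obtain i j where ij: "?ps ! k = (i, j)" by force
    then have "j < i" "i < m" using nth_mem[OF k] by (auto simp: set_lower_pos)
    then have "S $$ (?ps ! k) = v $ k" using g[OF k] by (simp add: S_def ij)
    then show "veck S $ k = v $ k"
      using k by (simp add: veck_eq_lower_pos[OF S] vec_of_list_index)
  qed
  ultimately show ?thesis by blast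
qed

lemma veck_inj:
  assumes S: "S \<in> Skew m" and T: "T \<in> Skew m" and eq: "veck S = veck T"
  shows "S = T"
proof -
  have SC: "S \<in> carrier_mat m m" "T \<in> carrier_mat m m" using S T by (auto simp: Skew_def)
  have low: "S $$ (i, j) = T $$ (i, j)" if "j < i" "i < m" for i j
  proof -
    have "map (\<lambda>ij. S $$ ij) (lower_pos m) = map (\<lambda>ij. T $$ ij) (lower_pos m)"
      using arg_cong[OF eq, of list_of_vec] SC by (simp only: veck_eq_lower_pos list_vec)
    moreover have "(i, j) \<in> set (lower_pos m)" using that by (simp add: set_lower_pos)
    ultimately show ?thesis by (auto simp only: map_eq_conv)
  qed
  have sk: "X $$ (i, j) = - X $$ (j, i)" if "X \<in> Skew m" "i < m" "j < m" for X i j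
  proof -
    have X: "X \<in> carrier_mat m m" and "X\<^sup>T = - X" using that by (auto simp: Skew_def)
    then have "X\<^sup>T $$ (j, i) = (- X) $$ (j, i)" by simp
    moreover have "X\<^sup>T $$ (j, i) = X $$ (i, j)" "(- X) $$ (j, i) = - X $$ (j, i)"
      using X that by auto
    ultimately show ?thesis by simp
  qed
  show ?thesis
  proof (rule eq_matI)
    fix i j assume "i < dim_row T" "j < dim_col T"
    then have ij: "i < m" "j < m" using SC by auto
    consider "j < i" | "i < j" | "i = j" by linarith
    then show "S $$ (i, j) = T $$ (i, j)"
    proof cases
      case 2
      with low[of i j] ij sk[OF S ij] sk[OF T ij] show ?thesis using low by simp
    next
      case 3
      with sk[OF S ij] sk[OF T ij] show ?thesis by simp
    qed (use low ij in auto)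
  qed (use SC in auto)
qed

lemma vec_op_inj:
  assumes "C \<in> carrier_mat r c" "C' \<in> carrier_mat r c" "vec_op C = vec_op C'"
  shows "C = C'"
proof (rule eq_matI)
  fix i j assume "i < dim_row C'" "j < dim_col C'"
  then have ij: "i < r" "j < c" using assms by auto
  have "i + j * r < r + j * r" using ij by simp
  also have "\<dots> \<le> r * c" using ij mult_le_mono1[of "Suc j" c r] by (simp add: mult.commute)
  finally have "i + j * r < r * c" .
  then show "C $$ (i, j) = C' $$ (i, j)"
    using arg_cong[OF assms(3), of "\<lambda>v. v $ (i + j * r)"] assms(1,2) ij by (auto simp: vec_op_def)
qed (use assms in auto)

lemma ex_vec_op:
  assumes "v \<in> carrier_vec (r * c)"
  shows "\<exists>C\<in>carrier_mat r c. vec_op C = v"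
proof (intro bexI eq_vecI)
  show "mat r c (\<lambda>(i, j). v $ (i + j * r)) \<in> carrier_mat r c" by simp
  fix k assume "k < dim_vec v"
  then have k: "k < r * c" using assms by simp
  then have "0 < r" by (cases r) auto
  with k have "k mod r < r" "k div r < c"
    by (auto simp: less_mult_imp_div_less mult.commute)
  then show "vec_op (mat r c (\<lambda>(i, j). v $ (i + j * r))) $ k = v $ k"
    using k by (simp add: vec_op_def)
qed (use assms in \<open>simp add: vec_op_def\<close>)

lemma bij_betw_coords:
  "bij_betw (\<lambda>(B, C). veck B @\<^sub>v vec_op C) (Skew p \<times> carrier_mat q p)
     (carrier_vec (p * (p - 1) div 2 + p * q))"
proof -
  have dim: "veck B \<in> carrier_vec (p * (p - 1) div 2)" if "B \<in> Skew p" for B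
    using that by (intro carrier_vecI)
      (auto simp: Skew_def veck_eq_lower_pos[of B p] length_lower_pos)
  have dim': "vec_op C \<in> carrier_vec (p * q)" if "C \<in> carrier_mat q p" for C
    using that by (intro carrier_vecI) (auto simp: vec_op_def mult.commute)
  show ?thesis
    unfolding bij_betw_def
  proof (intro conjI inj_onI subset_antisym subsetI)
    fix x y assume x: "x \<in> Skew p \<times> carrier_mat q p" and y: "y \<in> Skew p \<times> carrier_mat q p"
      and eq: "(case x of (B, C) \<Rightarrow> veck B @\<^sub>v vec_op C) = (case y of (B, C) \<Rightarrow> veck B @\<^sub>v vec_op C)"
    obtain B C B' C' where xy: "x = (B, C)" "y = (B', C')" by fastforce
    from x y eq have "veck B = veck B' \<and> vec_op C = vec_op C'"
      by (subst append_vec_eq[symmetric, OF dim dim]) (auto simp: xy)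
    with x y show "x = y" by (auto simp: xy dest: veck_inj vec_op_inj)
  next
    fix v assume "v \<in> (\<lambda>(B, C). veck B @\<^sub>v vec_op C) ` (Skew p \<times> carrier_mat q p)"
    then show "v \<in> carrier_vec (p * (p - 1) div 2 + p * q)"
      using dim dim' by (auto simp del: carrier_vec_dim_vec intro!: append_carrier_vec)
  next
    fix v :: "real vec" assume v: "v \<in> carrier_vec (p * (p - 1) div 2 + p * q)"
    let ?k = "p * (p - 1) div 2"
    obtain B where B: "B \<in> Skew p" "veck B = vec_first v ?k"
      using ex_skew_veck[OF vec_first_carrier] by blast
    have "vec_last v (p * q) \<in> carrier_vec (q * p)"
      by (simp add: mult.commute)
    then obtain C where C: "C \<in> carrier_mat q p" "vec_op C = vec_last v (p * q)"
      using ex_vec_op by blast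
    have "v = veck B @\<^sub>v vec_op C"
      using vec_first_last_append[OF v] by (simp add: B C)
    with B C show "v \<in> (\<lambda>(B, C). veck B @\<^sub>v vec_op C) ` (Skew p \<times> carrier_mat q p)"
      by force
  qed
qed

end

theory Submission
  imports Defs
begin

text \<open>The vectors \<open>veck B @\<^sub>v vec_op C\<close> exhaust \<open>\<real>\<^sup>K\<close>, so it suffices to compare both sides on them.
  There \<open>vec (P X Q) = (Q\<^sup>T \<otimes> P) vec X\<close> and \<open>vec (diag X) = \<Delta> vec X\<close> turn each
  summand of \<open>B_H\<close> and \<open>C_H\<close> into a matrix acting on \<open>vec B\<close> and \<open>vec C\<close>. The matrix \<open>D\<close> passes from
  \<open>veck B\<close> to \<open>vec B\<close>, and \<open>D\<^sup>T vec W = 2 veck (skew W)\<close> passes back; this factor 2 is why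
  \<open>H11\<close> and \<open>H12\<close> carry \<open>-2\<close> instead of \<open>-4\<close>.\<close>

section \<open>Finite sums of matrices of a fixed size\<close>

lemma abelian_monoid_module_mat: "abelian_monoid (module_mat TYPE(real) r c)"
  by (rule abelian_group.axioms(1)[OF abelian_group_mat])

lemma msum_empty [simp]: "msum r c F {} = 0\<^sub>m r c"
  using abelian_monoid.finsum_empty[OF abelian_monoid_module_mat]
  by (simp add: module_mat_def)

lemma msum_insert:
  assumes "finite I" "l \<notin> I" "F l \<in> carrier_mat r c" "\<And>k. k \<in> I \<Longrightarrow> F k \<in> carrier_mat r c"
  shows "msum r c F (insert l I) = F l + msum r c F I"
  using abelian_monoid.finsum_insert[OF abelian_monoid_module_mat[of r c] assms(1,2), of F] assms(3,4)
  by (auto simp: module_mat_def)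

lemma msum_carrier [simp]:
  assumes "\<And>l. l \<in> I \<Longrightarrow> F l \<in> carrier_mat r c"
  shows "msum r c F I \<in> carrier_mat r c"
  using abelian_monoid.finsum_closed[OF abelian_monoid_module_mat[of r c], of F I] assms
  by (auto simp: module_mat_def)

lemma msum_cong:
  assumes "\<And>l. l \<in> I \<Longrightarrow> F l = G l" "\<And>l. l \<in> I \<Longrightarrow> F l \<in> carrier_mat r c"
  shows "msum r c F I = msum r c G I"
  using assms
  by (intro abelian_monoid.finsum_cong'[OF abelian_monoid_module_mat]) (auto simp: module_mat_def)

text \<open>Bridge from the module sum to sums of reals: the facts on \<open>Delta_mat\<close> and
  \<open>D_mat\<close>, \<open>msum_add\<close> and \<open>skew_part_msum\<close> are all checked
  entry by entry through it.\<close>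

lemma index_msum:
  assumes "finite I" "\<And>l. l \<in> I \<Longrightarrow> F l \<in> carrier_mat r c" "i < r" "j < c"
  shows "msum r c F I $$ (i, j) = (\<Sum>l\<in>I. F l $$ (i, j))"
  using assms(1,2)
proof (induction I)
  case (insert l I)
  have "msum r c F I \<in> carrier_mat r c" by (rule msum_carrier) (use insert in auto)
  then have "i < dim_row (msum r c F I)" "j < dim_col (msum r c F I)" using assms(3,4) by auto
  with insert show ?case by (simp add: msum_insert)
qed (use assms in simp)

section \<open>Linearity of vectorization\<close>

lemma vec_op_carrier [simp]:
  "W \<in> carrier_mat r c \<Longrightarrow> vec_op W \<in> carrier_vec (c * r)"
  by (intro carrier_vecI) (simp add: vec_op_def)

lemma dim_vec_op [simp]: "dim_vec (vec_op W) = dim_col W * dim_row W"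
  by (simp add: vec_op_def)

lemma mod_div_bounds:
  fixes k a b :: nat
  assumes "k < a * b"
  shows "k div b < a" "k mod b < b"
proof -
  have "0 < b" using assms by (cases b) auto
  then show "k div b < a" "k mod b < b"
    using assms by (auto simp: less_mult_imp_div_less)
qed

lemma mod_div_boundsE:
  fixes k a b :: nat
  assumes "k < a * b"
  obtains "k div b < a" "k mod b < b"
  using mod_div_bounds[OF assms] that by blast

lemma index_vec_op:
  "k < dim_col W * dim_row W \<Longrightarrow> vec_op W $ k = W $$ (k mod dim_row W, k div dim_row W)"
  by (simp add: vec_op_def mult.commute)

lemma vec_op_add:
  assumes "U \<in> carrier_mat r c" "W \<in> carrier_mat r c"
  shows "vec_op (U + W) = vec_op U + vec_op W"
  by (rule eq_vecI) (use assms in \<open>auto simp: index_vec_op elim!: mod_div_boundsE\<close>)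

lemma vec_op_minus:
  assumes "U \<in> carrier_mat r c" "W \<in> carrier_mat r c"
  shows "vec_op (U - W) = vec_op U - vec_op W"
  by (rule eq_vecI) (use assms in \<open>auto simp: index_vec_op elim!: mod_div_boundsE\<close>)

lemma vec_op_smult: "vec_op (a \<cdot>\<^sub>m W) = a \<cdot>\<^sub>v vec_op W"
  by (rule eq_vecI) (auto simp: index_vec_op elim!: mod_div_boundsE)

text \<open>Lifts an identity for single summands to the whole sum. It serves
  \<open>Delta_mat\<close> and each of the four blocks. The height is written \<open>b * a\<close>,
  columns first, to agree with the sizes of Kronecker products.\<close>

lemma msum_mult_vec_op:
  assumes "finite I" "v \<in> carrier_vec c"
    and "\<And>l. l \<in> I \<Longrightarrow> F l \<in> carrier_mat (b * a) c"
    and "\<And>l. l \<in> I \<Longrightarrow> G l \<in> carrier_mat a b"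
    and "\<And>l. l \<in> I \<Longrightarrow> F l *\<^sub>v v = vec_op (G l)"
  shows "msum (b * a) c F I *\<^sub>v v = vec_op (msum a b G I)"
  using assms(1,3-)
proof (induction I)
  case empty
  show ?case
    by (rule eq_vecI) (use assms(2) in \<open>auto simp: index_vec_op elim!: mod_div_boundsE\<close>)
next
  case (insert l I)
  have "msum (b * a) c F I \<in> carrier_mat (b * a) c" "msum a b G I \<in> carrier_mat a b"
    by (rule msum_carrier; use insert in auto)+
  with insert show ?case
    using assms(2)
    by (simp add: msum_insert vec_op_add[of _ a b] add_mult_distrib_mat_vec[of _ "b * a" c])
qed

section \<open>Kronecker products acting on vectorized matrices\<close>

lemma sum_lessThan_mult:
  fixes f :: "nat \<Rightarrow> real"
  shows "sum f {0..<b * d} = (\<Sum>j<b. \<Sum>i<d. f (i + j * d))"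
proof -
  \<comment> \<open>The range is cut into \<open>b\<close> blocks of length \<open>d\<close>; in a
    vectorized \<open>d\<close> by \<open>b\<close> matrix, block \<open>j\<close> is column
    \<open>j\<close>.\<close>
  have "sum f {0..<b * d} = (\<Sum>j<b. sum f {j * d..<j * d + d})"
    using sum.nat_group[of f d b] by (simp add: lessThan_atLeast0)
  also have "\<dots> = (\<Sum>j<b. \<Sum>i<d. f (i + j * d))"
  proof (rule sum.cong[OF refl])
    fix j
    show "sum f {j * d..<j * d + d} = (\<Sum>i<d. f (i + j * d))"
      using sum.shift_bounds_nat_ivl[of f 0 "j * d" d]
      by (simp add: lessThan_atLeast0 add.commute[of d])
  qed
  finally show ?thesis .
qed

lemma kronecker_carrier [simp]:
  "A \<in> carrier_mat a b \<Longrightarrow> B \<in> carrier_mat c d \<Longrightarrow> A \<otimes>\<^sub>K B \<in> carrier_mat (a * c) (b * d)"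
  by (auto simp: kronecker_def)

text \<open>Rows and columns of the Kronecker product are decoded by \<open>div\<close> and
  \<open>mod\<close> exactly as \<open>vec_op\<close> decodes its index. Entry \<open>k\<close> is
  therefore a double sum over the entries of \<open>X\<close>, namely the entry of
  \<open>B * X * A\<close>-transposed in row \<open>k mod c\<close> and column
  \<open>k div c\<close>.\<close>

lemma kronecker_mult_vec_op:
  assumes A: "A \<in> carrier_mat a b" and B: "B \<in> carrier_mat c d" and X: "X \<in> carrier_mat d b"
  shows "(A \<otimes>\<^sub>K B) *\<^sub>v vec_op X = vec_op (B * X * A\<^sup>T)"
proof (rule eq_vecI)
  show "dim_vec ((A \<otimes>\<^sub>K B) *\<^sub>v vec_op X) = dim_vec (vec_op (B * X * A\<^sup>T))"
    using assms by (simp add: kronecker_def)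
  fix k assume "k < dim_vec (vec_op (B * X * A\<^sup>T))"
  then have k: "k < a * c" using A B by simp
  note kb = mod_div_bounds[OF k]
  have "((A \<otimes>\<^sub>K B) *\<^sub>v vec_op X) $ k = (\<Sum>t\<in>{0..<b * d}. (A \<otimes>\<^sub>K B) $$ (k, t) * vec_op X $ t)"
    using k A B X by (simp add: scalar_prod_def kronecker_def mult.commute)
  also have "\<dots> = (\<Sum>t\<in>{0..<b * d}. A $$ (k div c, t div d) * B $$ (k mod c, t mod d)
      * X $$ (t mod d, t div d))"
    using k A B X by (intro sum.cong refl) (simp add: kronecker_def index_vec_op)
  also have "\<dots> = (\<Sum>j<b. \<Sum>i<d. A $$ (k div c, j) * B $$ (k mod c, i) * X $$ (i, j))"
    by (auto simp: sum_lessThan_mult intro!: sum.cong)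
  also have "\<dots> = (\<Sum>j<b. (\<Sum>i<d. B $$ (k mod c, i) * X $$ (i, j)) * A $$ (k div c, j))"
    by (simp add: sum_distrib_left sum_distrib_right ac_simps)
  \<comment> \<open>With the product bracketed to the left, its entry expands to this nested sum,
    the entry of \<open>B * X\<close> being the inner one.\<close>
  also have "\<dots> = (B * X * A\<^sup>T) $$ (k mod c, k div c)"
    using kb A B X by (simp add: scalar_prod_def lessThan_atLeast0 del: assoc_mult_mat)
  also have "\<dots> = vec_op (B * X * A\<^sup>T) $ k"
    using k A B by (simp add: index_vec_op)
  finally show "((A \<otimes>\<^sub>K B) *\<^sub>v vec_op X) $ k = vec_op (B * X * A\<^sup>T) $ k" .
qed

section \<open>Diagonal, symmetric and skew parts, and the matrix \<open>Delta_mat\<close>\<close>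

lemma diag_part_carrier [simp]: "W \<in> carrier_mat r c \<Longrightarrow> diag_part W \<in> carrier_mat r c"
  by (simp add: diag_part_def)

lemma sym_part_carrier [simp]: "W \<in> carrier_mat m m \<Longrightarrow> sym_part W \<in> carrier_mat m m"
  by (simp add: sym_part_def)

lemma skew_part_carrier [simp]: "W \<in> carrier_mat m m \<Longrightarrow> skew_part W \<in> carrier_mat m m"
  by (simp add: skew_part_def minus_carrier_mat)

lemma transpose_diag_part: "W \<in> carrier_mat m m \<Longrightarrow> (diag_part W)\<^sup>T = diag_part W"
  by (rule eq_matI) (auto simp: diag_part_def)

lemma transpose_sym_part: "W \<in> carrier_mat m m \<Longrightarrow> (sym_part W)\<^sup>T = sym_part W"
  by (rule eq_matI) (auto simp: sym_part_def)

lemma diag_part_add: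
  assumes "U \<in> carrier_mat r c" "W \<in> carrier_mat r c"
  shows "diag_part (U + W) = diag_part U + diag_part W"
  by (rule eq_matI) (use assms in \<open>auto simp: diag_part_def\<close>)

lemma E_mat_carrier [simp]: "E_mat a b i j \<in> carrier_mat a b"
  by (simp add: E_mat_def)

lemma Delta_mat_carrier [simp]: "Delta_mat m \<in> carrier_mat (m * m) (m * m)"
  unfolding Delta_mat_def by (rule msum_carrier) simp

text \<open>The left factor keeps only row \<open>i\<close>, the right factor only column
  \<open>i\<close>. Positions in \<open>E_mat\<close> are counted from 1, hence the
  \<open>Suc\<close>.\<close>

lemma E_mat_sandwich:
  assumes "X \<in> carrier_mat m m" "r < m" "c < m"
  shows "(E_mat m m i i * X * (E_mat m m i i)\<^sup>T) $$ (r, c)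
    = (if Suc r = i \<and> Suc c = i then X $$ (r, c) else 0)"
proof -
  have "(E_mat m m i i * X) $$ (r, k) = (if Suc r = i then X $$ (r, k) else 0)" if "k < m" for k
    using assms that
    by (auto simp: E_mat_def scalar_prod_def if_distrib[of "\<lambda>x. x * _"] cong: if_cong)
  then show ?thesis
    using assms
    by (subst index_mult_mat)
      (auto simp: E_mat_def scalar_prod_def if_distrib[of "\<lambda>x. _ * x"] cong: if_cong)
qed

text \<open>By the Kronecker rule the \<open>i\<close>-th summand of \<open>Delta_mat\<close>
  isolates the \<open>i\<close>-th diagonal entry of \<open>X\<close>; the sum over \<open>i\<close>
  collects the diagonal.\<close>

lemma Delta_mat_mult_vec_op:
  assumes X: "X \<in> carrier_mat m m"
  shows "Delta_mat m *\<^sub>v vec_op X = vec_op (diag_part X)"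
proof -
  let ?G = "\<lambda>i. E_mat m m i i * X * (E_mat m m i i)\<^sup>T"
  have G: "?G i \<in> carrier_mat m m" for i
    using X by (simp add: mult_carrier_mat[of _ m m])
  have "Delta_mat m *\<^sub>v vec_op X = vec_op (msum m m ?G {1..m})"
    unfolding Delta_mat_def
    by (rule msum_mult_vec_op)
      (use X G in \<open>simp_all add: kronecker_mult_vec_op[of _ m m _ m m]\<close>)
  also have "msum m m ?G {1..m} = diag_part X"
  proof (rule eq_matI)
    fix r c assume "r < dim_row (diag_part X)" "c < dim_col (diag_part X)"
    then have rc: "r < m" "c < m" using X by (auto simp: diag_part_def)
    have "msum m m ?G {1..m} $$ (r, c) = (\<Sum>i=1..m. ?G i $$ (r, c))"
      using G rc by (intro index_msum) auto
    \<comment> \<open>At a given position at most the summand \<open>i = Suc r\<close> contributes,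
      and only on the diagonal; the nested conditional brings this into the form of a one-point
      sum.\<close>
    also have "\<dots> = (\<Sum>i=1..m. if i = Suc r then (if r = c then X $$ (r, c) else 0) else 0)"
      using X rc by (intro sum.cong refl) (auto simp: E_mat_sandwich)
    also have "\<dots> = diag_part X $$ (r, c)"
      using rc X by (simp add: diag_part_def)
    finally show "msum m m ?G {1..m} $$ (r, c) = diag_part X $$ (r, c)" .
  qed (use X msum_carrier[of "{1..m}" ?G m m, OF G] in \<open>auto simp: diag_part_def\<close>)
  finally show ?thesis .
qed

section \<open>The matrix \<open>D_mat\<close> and the order of the entries in
  \<open>veck\<close>\<close>

text \<open>Here \<open>c\<close> is the column that \<open>D_mat\<close> assigns to the pair with 1-based indices
  \<open>(Suc i, Suc j)\<close>; it is itself counted from 1.\<close>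

lemma nth_lower_pos:
  assumes ji: "j < i" and im: "i < m"
  defines "c \<equiv> Suc j * m + Suc i - Suc j * (Suc j + 1) div 2 - m"
  shows "1 \<le> c \<and> c \<le> m * (m - 1) div 2 \<and> lower_pos m ! (c - 1) = (i, j)"
proof -
  let ?L = "\<lambda>k. concat (map (\<lambda>j. map (\<lambda>i. (i, j)) [Suc j..<m]) [0..<k])"
  \<comment> \<open>Column \<open>j\<close> of the strict lower triangle has
    \<open>m - 1 - j\<close> entries, so the first \<open>k\<close> columns hold
    \<open>k * m - k * (k + 1) / 2\<close> of them. The equation is doubled and rearranged to avoid
    truncated subtraction and division on \<open>nat\<close>.\<close>
  have len: "k \<le> m \<Longrightarrow> 2 * length (?L k) + k * (k + 1) = 2 * k * m" for k
  proof (induction k)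
    case (Suc k)
    then obtain d where "m = Suc k + d" by (metis le_Suc_ex)
    with Suc show ?case by (simp add: algebra_simps)
  qed simp
  have "[0..<m] = [0..<j] @ j # [Suc j..<m]"
    using ji im upt_add_eq_append[of 0 j "m - j"] by (simp add: upt_conv_Cons)
  then have split: "lower_pos m = ?L j @ map (\<lambda>i. (i, j)) [Suc j..<m]
      @ concat (map (\<lambda>j. map (\<lambda>i. (i, j)) [Suc j..<m]) [Suc j..<m])"
    by (simp add: lower_pos_def)
  \<comment> \<open>The position counted from 0: all earlier columns, then the offset in column
    \<open>j\<close>, whose list starts at row \<open>Suc j\<close>.\<close>
  let ?k = "length (?L j) + (i - Suc j)"
  have nth: "lower_pos m ! ?k = (i, j)"
    unfolding split nth_append using ji im by (auto simp: nth_append)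
  have bound: "?k < length (lower_pos m)"
    unfolding split using ji im by auto
  \<comment> \<open>Writing the product of consecutive numbers as \<open>2 * t\<close> removes
    \<open>div\<close> from the formula for \<open>c\<close>.\<close>
  have "even (Suc j * (Suc j + 1))" by auto
  then obtain t where t: "Suc j * (Suc j + 1) = 2 * t" by blast
  have "2 * length (?L j) + j * (j + 1) = 2 * j * m" using len[of j] ji im by simp
  moreover have "j * (j + 1) + 2 * (j + 1) = 2 * t" using t by (simp add: algebra_simps)
  ultimately have "length (?L j) + t = j * m + (j + 1)" by simp
  then have "c = Suc ?k"
    using ji unfolding c_def t by simp
  with nth bound show ?thesis by (simp add: length_lower_pos)
qed

lemma D_mat_carrier: "D_mat m \<in> carrier_mat (m * m) (m * (m - 1) div 2)"
  unfolding D_mat_def power2_eq_square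
  by (rule msum_carrier) (auto simp: Let_def minus_carrier_mat)

text \<open>Different pairs are assigned different columns, so only the summand of the pair listed
  at position \<open>l\<close> reaches column \<open>l\<close>. Its entries 1 and -1 stand where
  \<open>vec_op\<close> puts the positions \<open>(i, j)\<close> and \<open>(j, i)\<close>, all
  counted from 0.\<close>

lemma index_D_mat:
  assumes k: "k < m * m" and l: "l < length (lower_pos m)" and ij: "lower_pos m ! l = (i, j)"
  shows "D_mat m $$ (k, l) = of_bool (k = i + j * m) - of_bool (k = j + i * m)"
proof -
  let ?c = "\<lambda>i j. j * m + i - j * (j + 1) div 2 - m"
  let ?w = "m * (m - 1) div 2"
  let ?I = "{(i, j). 1 \<le> j \<and> j < i \<and> i \<le> m}"
  have fin: "finite ?I"
    by (rule finite_subset[of _ "{..m} \<times> {..m}"]) auto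
  have lw: "l < ?w" using l by (simp add: length_lower_pos)
  have ji: "j < i" "i < m" using nth_mem[OF l] by (auto simp: ij set_lower_pos)
  \<comment> \<open>Since \<open>lower_pos m\<close> has no repetitions, comparing column numbers
    amounts to comparing the listed pairs. \<open>Suc\<close> translates from indices counted from 0
    to those of \<open>D_mat\<close>.\<close>
  have eq_iff: "Suc l = ?c i' j' \<longleftrightarrow> (i', j') = (Suc i, Suc j)" if "(i', j') \<in> ?I" for i' j'
  proof -
    from that obtain i0 j0 where 0: "i' = Suc i0" "j' = Suc j0" "j0 < i0" "i0 < m"
      by (cases i'; cases j') auto
    have P: "1 \<le> ?c i' j' \<and> ?c i' j' \<le> ?w \<and> lower_pos m ! (?c i' j' - 1) = (i0, j0)"
      using nth_lower_pos[OF 0(3,4)] by (simp only: 0(1,2))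
    then have "Suc l = ?c i' j' \<longleftrightarrow> l = ?c i' j' - 1" by linarith
    also have "\<dots> \<longleftrightarrow> lower_pos m ! l = lower_pos m ! (?c i' j' - 1)"
      using l P by (subst nth_eq_iff_index_eq[OF distinct_lower_pos]) (linarith | simp add: length_lower_pos)+
    finally show ?thesis using P by (auto simp: ij 0)
  qed
  have "D_mat m $$ (k, l) = (\<Sum>(i', j')\<in>?I.
     (E_mat (m\<^sup>2) ?w (m * (j' - 1) + i') (?c i' j') - E_mat (m\<^sup>2) ?w (m * (i' - 1) + j') (?c i' j')) $$ (k, l))"
    unfolding D_mat_def Let_def
    by (subst index_msum[OF fin])
      (use k lw in \<open>auto simp: power2_eq_square minus_carrier_mat intro!: sum.cong\<close>)
  also have "\<dots> = (\<Sum>x\<in>?I. if x = (Suc i, Suc j)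
      then of_bool (k = i + j * m) - of_bool (k = j + i * m) else 0)"
  proof (intro sum.cong refl)
    fix x assume x: "x \<in> ?I"
    obtain i' j' where x': "x = (i', j')" by force
    show "(case x of (i', j') \<Rightarrow> (E_mat (m\<^sup>2) ?w (m * (j' - 1) + i') (?c i' j')
        - E_mat (m\<^sup>2) ?w (m * (i' - 1) + j') (?c i' j')) $$ (k, l))
      = (if x = (Suc i, Suc j) then of_bool (k = i + j * m) - of_bool (k = j + i * m) else 0)"
      using k lw eq_iff[of i' j'] x unfolding x' E_mat_def
      by (auto simp: power2_eq_square algebra_simps)
  qed
  also have "\<dots> = of_bool (k = i + j * m) - of_bool (k = j + i * m)"
    using ji fin by simp
  finally show ?thesis .
qed

lemma pair_index_eq_iff:
  fixes i j r c m :: nat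
  assumes "i < m" "r < m"
  shows "i + j * m = r + c * m \<longleftrightarrow> i = r \<and> j = c"
proof
  assume eq: "i + j * m = r + c * m"
  have "(i + j * m) mod m = i" "(r + c * m) mod m = r"
    "(i + j * m) div m = j" "(r + c * m) div m = c" using assms by auto
  with eq show "i = r \<and> j = c" by metis
qed simp

lemma pair_index_less:
  fixes i j m :: nat
  assumes "i < m" "j < b"
  shows "i + j * m < b * m"
proof -
  have "i + j * m < Suc j * m" using assms by simp
  also have "\<dots> \<le> b * m" using assms by (intro mult_le_mono1) simp
  finally show ?thesis .
qed

lemma veck_carrier [simp]: "S \<in> carrier_mat m m \<Longrightarrow> veck S \<in> carrier_vec (m * (m - 1) div 2)"
  by (intro carrier_vecI) (simp add: veck_eq_lower_pos length_lower_pos)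

lemma index_veck:
  assumes "S \<in> carrier_mat m m" "l < length (lower_pos m)"
  shows "veck S $ l = S $$ (lower_pos m ! l)"
  using assms by (simp add: veck_eq_lower_pos vec_of_list_index)

lemma Skew_index:
  assumes "S \<in> Skew m" "i < m" "j < m"
  shows "S $$ (j, i) = - S $$ (i, j)"
proof -
  have S: "S \<in> carrier_mat m m" and "S\<^sup>T = - S" using assms by (auto simp: Skew_def)
  then have "S\<^sup>T $$ (i, j) = (- S) $$ (i, j)" by simp
  then show ?thesis using S assms by simp
qed

text \<open>Row \<open>r + c * m\<close> of \<open>D_mat m\<close> is 1 at the pair
  \<open>(r, c)\<close> if \<open>c < r\<close>, -1 at the pair \<open>(c, r)\<close> if
  \<open>r < c\<close>, and 0 elsewhere. Skewness of \<open>S\<close> turns each case into the entry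
  of \<open>S\<close> at \<open>(r, c)\<close>.\<close>

lemma D_mat_mult_veck:
  assumes S: "S \<in> Skew m"
  shows "D_mat m *\<^sub>v veck S = vec_op S"
proof (rule eq_vecI)
  have SC: "S \<in> carrier_mat m m" using S by (simp add: Skew_def)
  have DC: "D_mat m \<in> carrier_mat (m * m) (length (lower_pos m))"
    unfolding length_lower_pos by (rule D_mat_carrier)
  have dim_veck: "dim_vec (veck S) = length (lower_pos m)"
    using SC by (simp add: veck_eq_lower_pos)
  show "dim_vec (D_mat m *\<^sub>v veck S) = dim_vec (vec_op S)" using SC DC by simp
  fix k assume "k < dim_vec (vec_op S)"
  then have k: "k < m * m" using SC by simp
  define r c where "r = k mod m" and "c = k div m"
  have rc: "r < m" "c < m" and kk: "k = r + c * m"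
    using mod_div_bounds[OF k] by (auto simp: r_def c_def)
  let ?d = "\<lambda>(i, j). of_bool (k = i + j * m) - of_bool (k = j + i * m) :: real"
  let ?P = "{(i, j). j < i \<and> i < m}"
  have finP: "finite ?P" by (rule finite_subset[of _ "{..<m} \<times> {..<m}"]) auto
  have "(D_mat m *\<^sub>v veck S) $ k
      = (\<Sum>l\<in>{0..<length (lower_pos m)}. D_mat m $$ (k, l) * S $$ (lower_pos m ! l))"
    using k DC SC
    by (auto simp: scalar_prod_def index_veck dim_veck intro!: sum.cong)
  also have "\<dots> = (\<Sum>l\<in>{0..<length (lower_pos m)}. ?d (lower_pos m ! l) * S $$ (lower_pos m ! l))"
    using k by (intro sum.cong refl) (auto simp: index_D_mat split: prod.split)
  \<comment> \<open>The enumeration \<open>lower_pos m\<close> is a bijection, so the sum over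
    columns becomes a sum over strictly lower pairs.\<close>
  also have "\<dots> = (\<Sum>x\<in>?P. ?d x * S $$ x)"
    unfolding set_lower_pos[symmetric]
    by (rule sum.reindex_bij_betw) 
      (rule bij_betw_nth, auto simp: distinct_lower_pos lessThan_atLeast0)
  \<comment> \<open>At the pair \<open>(c, r)\<close> the sign -1 cancels against the sign from
    skewness, so both cases give the same value.\<close>
  also have "\<dots> = (\<Sum>x\<in>?P. (if x = (r, c) then S $$ (r, c) else 0)
      + (if x = (c, r) then S $$ (r, c) else 0))"
  proof (intro sum.cong refl)
    fix x assume "x \<in> ?P"
    then obtain i j where x: "x = (i, j)" "j < i" "i < m" by auto
    then show "?d x * S $$ x = (if x = (r, c) then S $$ (r, c) else 0)
      + (if x = (c, r) then S $$ (r, c) else 0)"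
      using rc Skew_index[OF S, of r c] pair_index_eq_iff[of r m i c j]
        pair_index_eq_iff[of r m j c i]
      by (auto simp: kk)
  qed
  \<comment> \<open>Off the diagonal exactly one of \<open>(r, c)\<close> and \<open>(c, r)\<close>
    lies in the index set; on the diagonal neither does, and the entry of \<open>S\<close> is
    0.\<close>
  also have "\<dots> = S $$ (r, c)"
    using rc finP Skew_index[OF S, of r r] by (auto simp: sum.distrib)
  also have "\<dots> = vec_op S $ k" using k SC by (simp add: index_vec_op r_def c_def)
  finally show "(D_mat m *\<^sub>v veck S) $ k = vec_op S $ k" .
qed

text \<open>Column \<open>l\<close> of \<open>D_mat m\<close> pairs with \<open>vec_op W\<close> to
  the difference of the entries of \<open>W\<close> at \<open>(i, j)\<close> and
  \<open>(j, i)\<close>, which is twice an entry of the skew part.\<close>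

lemma transpose_D_mat_mult_vec_op:
  assumes W: "W \<in> carrier_mat m m"
  shows "(D_mat m)\<^sup>T *\<^sub>v vec_op W = 2 \<cdot>\<^sub>v veck (skew_part W)"
proof (rule eq_vecI)
  have DC: "D_mat m \<in> carrier_mat (m * m) (length (lower_pos m))"
    unfolding length_lower_pos by (rule D_mat_carrier)
  have dim: "dim_vec (veck (skew_part W)) = length (lower_pos m)"
    using skew_part_carrier[OF W] by (simp add: veck_eq_lower_pos)
  show "dim_vec ((D_mat m)\<^sup>T *\<^sub>v vec_op W) = dim_vec (2 \<cdot>\<^sub>v veck (skew_part W))"
    using DC dim by simp
  fix l assume "l < dim_vec (2 \<cdot>\<^sub>v veck (skew_part W))"
  then have l: "l < length (lower_pos m)" by (simp add: dim)
  obtain i j where ij: "lower_pos m ! l = (i, j)" by force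
  then have ji: "j < i" "i < m" using nth_mem[OF l] by (auto simp: set_lower_pos)
  have lt: "i + j * m < m * m" "j + i * m < m * m"
    using ji by (auto intro!: pair_index_less)
  have "((D_mat m)\<^sup>T *\<^sub>v vec_op W) $ l = (\<Sum>k\<in>{0..<m * m}. D_mat m $$ (k, l) * vec_op W $ k)"
    using l DC W by (auto simp: scalar_prod_def intro!: sum.cong)
  also have "\<dots> = (\<Sum>k\<in>{0..<m * m}. (if k = i + j * m then vec_op W $ k else 0)
      - (if k = j + i * m then vec_op W $ k else 0))"
    using l ij by (intro sum.cong refl) (auto simp: index_D_mat)
  also have "\<dots> = W $$ (i, j) - W $$ (j, i)"
    using lt W ji by (simp add: sum_subtractf index_vec_op)
  also have "\<dots> = (2 \<cdot>\<^sub>v veck (skew_part W)) $ l"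
    using l dim ji W by (simp add: index_veck[OF skew_part_carrier[OF W]] ij) (simp add: skew_part_def)
  finally show "((D_mat m)\<^sup>T *\<^sub>v vec_op W) $ l = (2 \<cdot>\<^sub>v veck (skew_part W)) $ l" .
qed

section \<open>Scalars and sums under \<open>veck\<close> and the skew part\<close>

lemma veck_smult:
  assumes "S \<in> carrier_mat m m"
  shows "veck (a \<cdot>\<^sub>m S) = a \<cdot>\<^sub>v veck S"
proof (rule eq_vecI)
  fix l assume "l < dim_vec (a \<cdot>\<^sub>v veck S)"
  then have l: "l < length (lower_pos m)" using assms by (simp add: veck_eq_lower_pos)
  obtain i j where ij: "lower_pos m ! l = (i, j)" by force
  then have "j < i" "i < m" using nth_mem[OF l] by (auto simp: set_lower_pos)
  then show "veck (a \<cdot>\<^sub>m S) $ l = (a \<cdot>\<^sub>v veck S) $ l"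
    using assms l ij by (simp add: veck_eq_lower_pos[of _ m] vec_of_list_index)
qed (use assms in \<open>simp add: veck_eq_lower_pos[of _ m]\<close>)

lemma msum_add:
  assumes "finite I" "\<And>l. l \<in> I \<Longrightarrow> F l \<in> carrier_mat r c" "\<And>l. l \<in> I \<Longrightarrow> G l \<in> carrier_mat r c"
  shows "msum r c F I + msum r c G I = msum r c (\<lambda>l. F l + G l) I"
proof -
  have carr: "msum r c F I \<in> carrier_mat r c" "msum r c G I \<in> carrier_mat r c"
    "msum r c (\<lambda>l. F l + G l) I \<in> carrier_mat r c"
    by (rule msum_carrier; use assms(2,3) in auto)+
  have add: "(F l + G l) $$ (i, j) = F l $$ (i, j) + G l $$ (i, j)"
    if "l \<in> I" "i < r" "j < c" for l i j
    using assms(2,3)[OF that(1)] that(2,3) by simp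
  show ?thesis
  proof (rule eq_matI)
    fix i j assume "i < dim_row (msum r c (\<lambda>l. F l + G l) I)"
      "j < dim_col (msum r c (\<lambda>l. F l + G l) I)"
    then have "i < r" "j < c" using carr by auto
    moreover have "(msum r c F I + msum r c G I) $$ (i, j) = msum r c F I $$ (i, j) + msum r c G I $$ (i, j)"
      using carr(1,2) \<open>i < r\<close> \<open>j < c\<close> by auto
    ultimately show "(msum r c F I + msum r c G I) $$ (i, j) = msum r c (\<lambda>l. F l + G l) I $$ (i, j)"
      using assms add by (simp add: index_msum sum.distrib)
  qed (use carr in auto)
qed

text \<open>\<open>B_H\<close> takes the skew part of every summand, whereas the transpose of
  \<open>D_mat\<close> produces the skew part of the total; this reconciles the two.\<close>

lemma skew_part_msum:
  assumes "finite I" "\<And>l. l \<in> I \<Longrightarrow> W l \<in> carrier_mat m m"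
  shows "skew_part (msum m m W I) = msum m m (\<lambda>l. skew_part (W l)) I"
proof -
  have carr: "msum m m W I \<in> carrier_mat m m" "msum m m (\<lambda>l. skew_part (W l)) I \<in> carrier_mat m m"
    by (rule msum_carrier; use assms(2) in auto)+
  have idx: "skew_part S $$ (i, j) = (S $$ (i, j) - S $$ (j, i)) / 2"
    if "S \<in> carrier_mat m m" "i < m" "j < m" for S i j
    using that by (simp add: skew_part_def)
  show ?thesis
  proof (rule eq_matI)
    fix i j assume "i < dim_row (msum m m (\<lambda>l. skew_part (W l)) I)"
      "j < dim_col (msum m m (\<lambda>l. skew_part (W l)) I)"
    then have "i < m" "j < m" using carr by auto
    then show "skew_part (msum m m W I) $$ (i, j) = msum m m (\<lambda>l. skew_part (W l)) I $$ (i, j)"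
      using assms carr
      by (simp add: index_msum idx sum_subtractf flip: sum_divide_distrib)
  qed (simp_all add: carrier_matD[OF carr(2)] carrier_matD[OF skew_part_carrier[OF carr(1)]])
qed

section \<open>The block summands as operations on matrices\<close>

lemma smult_mult_mat_vec:
  fixes M :: "real mat"
  assumes "M \<in> carrier_mat r c" "v \<in> carrier_vec c"
  shows "(a \<cdot>\<^sub>m M) *\<^sub>v v = a \<cdot>\<^sub>v (M *\<^sub>v v)"
  by (rule eq_vecI) (use assms in auto)

text \<open>This is the common shape of all four blocks and alone covers the two off-diagonal ones.
  The product around \<open>Delta_mat\<close>, read from the right, sends \<open>X\<close> to
  \<open>Q * X\<close>, then to its diagonal part, then multiplies by \<open>P\<close>.\<close>

lemma kronecker_Delta_mult_vec_op:
  assumes D: "D \<in> carrier_mat p p" and R: "R \<in> carrier_mat a b" and P: "P \<in> carrier_mat a p"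
    and Q: "Q \<in> carrier_mat p b" and X: "X \<in> carrier_mat b p"
  shows "(D \<otimes>\<^sub>K R + 2 \<cdot>\<^sub>m ((1\<^sub>m p \<otimes>\<^sub>K P) * Delta_mat p * (1\<^sub>m p \<otimes>\<^sub>K Q))) *\<^sub>v vec_op X
    = vec_op (R * X * D\<^sup>T + 2 \<cdot>\<^sub>m (P * diag_part (Q * X)))"
proof -
  let ?K = "(1\<^sub>m p \<otimes>\<^sub>K P) * Delta_mat p * (1\<^sub>m p \<otimes>\<^sub>K Q)"
  have c: "1\<^sub>m p \<otimes>\<^sub>K P \<in> carrier_mat (p * a) (p * p)" "1\<^sub>m p \<otimes>\<^sub>K Q \<in> carrier_mat (p * p) (p * b)"
    "D \<otimes>\<^sub>K R \<in> carrier_mat (p * a) (p * b)"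
    using assms by simp_all
  have K: "?K \<in> carrier_mat (p * a) (p * b)"
    using c by (meson mult_carrier_mat Delta_mat_carrier)
  have vX: "vec_op X \<in> carrier_vec (p * b)" using X by simp
  have QX: "Q * X \<in> carrier_mat p p" using Q X by simp
  have "?K *\<^sub>v vec_op X = (1\<^sub>m p \<otimes>\<^sub>K P) * Delta_mat p *\<^sub>v ((1\<^sub>m p \<otimes>\<^sub>K Q) *\<^sub>v vec_op X)"
    by (rule assoc_mult_mat_vec[OF mult_carrier_mat[OF c(1) Delta_mat_carrier] c(2) vX])
  also have "(1\<^sub>m p \<otimes>\<^sub>K Q) *\<^sub>v vec_op X = vec_op (Q * X)"
    using kronecker_mult_vec_op[OF one_carrier_mat Q X]
    by (simp only: transpose_one right_mult_one_mat[OF QX])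
  also have "(1\<^sub>m p \<otimes>\<^sub>K P) * Delta_mat p *\<^sub>v vec_op (Q * X)
      = (1\<^sub>m p \<otimes>\<^sub>K P) *\<^sub>v (Delta_mat p *\<^sub>v vec_op (Q * X))"
    by (rule assoc_mult_mat_vec[OF c(1) Delta_mat_carrier vec_op_carrier[OF QX]])
  also have "\<dots> = vec_op (P * diag_part (Q * X))"
    using kronecker_mult_vec_op[OF one_carrier_mat P diag_part_carrier[OF QX]]
    by (simp only: Delta_mat_mult_vec_op[OF QX] transpose_one
        right_mult_one_mat[OF mult_carrier_mat[OF P diag_part_carrier[OF QX]]])
  finally have KX: "?K *\<^sub>v vec_op X = vec_op (P * diag_part (Q * X))" .
  have "(D \<otimes>\<^sub>K R + 2 \<cdot>\<^sub>m ?K) *\<^sub>v vec_op X = (D \<otimes>\<^sub>K R) *\<^sub>v vec_op X + 2 \<cdot>\<^sub>v (?K *\<^sub>v vec_op X)"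
    using add_mult_distrib_mat_vec[OF c(3) smult_carrier_mat[OF K] vX] smult_mult_mat_vec[OF K vX]
    by simp
  also have "\<dots> = vec_op (R * X * D\<^sup>T) + vec_op (2 \<cdot>\<^sub>m (P * diag_part (Q * X)))"
    by (simp only: KX vec_op_smult kronecker_mult_vec_op[OF D R X])
  also have "\<dots> = vec_op (R * X * D\<^sup>T + 2 \<cdot>\<^sub>m (P * diag_part (Q * X)))"
    by (rule vec_op_add[symmetric, of _ a p]) (use assms QX in \<open>auto intro!: mult_carrier_mat\<close>)
  finally show ?thesis .
qed

text \<open>For \<open>H11\<close> and \<open>H22\<close>: their extra Kronecker term with an
  identity as second factor is right multiplication of \<open>X\<close> by the transpose of
  \<open>S\<close>.\<close>

lemma kronecker_Delta_minus_mult_vec_op: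
  assumes D: "D \<in> carrier_mat p p" and R: "R \<in> carrier_mat a a" and P: "P \<in> carrier_mat a p"
    and Q: "Q \<in> carrier_mat p a" and X: "X \<in> carrier_mat a p" and S: "S \<in> carrier_mat p p"
  shows "(D \<otimes>\<^sub>K R + 2 \<cdot>\<^sub>m ((1\<^sub>m p \<otimes>\<^sub>K P) * Delta_mat p * (1\<^sub>m p \<otimes>\<^sub>K Q)) - S \<otimes>\<^sub>K 1\<^sub>m a) *\<^sub>v vec_op X
    = vec_op (R * X * D\<^sup>T + 2 \<cdot>\<^sub>m (P * diag_part (Q * X)) - X * S\<^sup>T)"
proof -
  let ?M = "D \<otimes>\<^sub>K R + 2 \<cdot>\<^sub>m ((1\<^sub>m p \<otimes>\<^sub>K P) * Delta_mat p * (1\<^sub>m p \<otimes>\<^sub>K Q))"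
  let ?W = "R * X * D\<^sup>T + 2 \<cdot>\<^sub>m (P * diag_part (Q * X))"
  have c: "1\<^sub>m p \<otimes>\<^sub>K P \<in> carrier_mat (p * a) (p * p)" "1\<^sub>m p \<otimes>\<^sub>K Q \<in> carrier_mat (p * p) (p * a)"
    using P Q by simp_all
  have M: "?M \<in> carrier_mat (p * a) (p * a)"
    using c by (meson add_carrier_mat smult_carrier_mat mult_carrier_mat Delta_mat_carrier)
  have SI: "S \<otimes>\<^sub>K 1\<^sub>m a \<in> carrier_mat (p * a) (p * a)" using S by simp
  have W: "?W \<in> carrier_mat a p"
    using P Q X by (meson add_carrier_mat smult_carrier_mat mult_carrier_mat diag_part_carrier)
  have "(?M - S \<otimes>\<^sub>K 1\<^sub>m a) *\<^sub>v vec_op X = ?M *\<^sub>v vec_op X - (S \<otimes>\<^sub>K 1\<^sub>m a) *\<^sub>v vec_op X"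
    using minus_mult_distrib_mat_vec[OF M SI vec_op_carrier[OF X]] .
  also have "\<dots> = vec_op ?W - vec_op (X * S\<^sup>T)"
    using kronecker_Delta_mult_vec_op[OF D R P Q X]
      kronecker_mult_vec_op[OF S one_carrier_mat X] X by simp
  also have "\<dots> = vec_op (?W - X * S\<^sup>T)"
    by (rule vec_op_minus[symmetric, OF W]) (use X S in \<open>auto intro!: mult_carrier_mat\<close>)
  finally show ?thesis .
qed

text \<open>Separates a summand of \<open>B_H\<close> or \<open>C_H\<close> into the share of
  \<open>B\<close> and the share of \<open>C\<close>. The subtracted term \<open>T\<close> involves
  only \<open>B\<close> in the former and only \<open>C\<close> in the latter, hence the two
  groupings.\<close>

lemma summand_split:
  fixes L1 L2 B C D P Z Z' T :: "real mat"
  assumes L: "L1 \<in> carrier_mat a p" "L2 \<in> carrier_mat a q"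
    and B: "B \<in> carrier_mat p p" and C: "C \<in> carrier_mat q p"
    and D: "D \<in> carrier_mat p p" and P: "P \<in> carrier_mat a p"
    and Z: "Z \<in> carrier_mat p p" "Z' \<in> carrier_mat p q" and T: "T \<in> carrier_mat a p"
  defines "X1 \<equiv> L1 * B * D + 2 \<cdot>\<^sub>m (P * diag_part (Z * B))"
    and "X2 \<equiv> L2 * C * D + 2 \<cdot>\<^sub>m (P * diag_part (Z' * C))"
    and "X \<equiv> (L1 * B + L2 * C) * D + 2 \<cdot>\<^sub>m (P * diag_part (Z * B + Z' * C)) - T"
  shows "(X1 - T) + X2 = X" "X1 + (X2 - T) = X"
proof -
  have c: "L1 * B \<in> carrier_mat a p" "L2 * C \<in> carrier_mat a p"
    "Z * B \<in> carrier_mat p p" "Z' * C \<in> carrier_mat p p"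
    using assms by simp_all
  have e: "L1 * B * D \<in> carrier_mat a p" "L2 * C * D \<in> carrier_mat a p"
    "P * diag_part (Z * B) \<in> carrier_mat a p" "P * diag_part (Z' * C) \<in> carrier_mat a p"
    using c D P by (meson mult_carrier_mat diag_part_carrier)+
  have "(L1 * B + L2 * C) * D = L1 * B * D + L2 * C * D"
    by (rule add_mult_distrib_mat[OF c(1,2) D])
  moreover have "P * diag_part (Z * B + Z' * C) = P * diag_part (Z * B) + P * diag_part (Z' * C)"
    unfolding diag_part_add[OF c(3,4)]
    by (rule mult_add_distrib_mat[OF P diag_part_carrier[OF c(3)] diag_part_carrier[OF c(4)]])
  ultimately have X: "X = (L1 * B * D + L2 * C * D)
      + 2 \<cdot>\<^sub>m (P * diag_part (Z * B) + P * diag_part (Z' * C)) - T"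
    unfolding X_def by simp
  \<comment> \<open>The products stay opaque matrices of known size, so only additive arithmetic on
    entries remains.\<close>
  show "(X1 - T) + X2 = X" "X1 + (X2 - T) = X"
    unfolding X X1_def X2_def
    by (rule eq_matI; use carrier_matD[OF e(1)] carrier_matD[OF e(2)] carrier_matD[OF e(3)]
      carrier_matD[OF e(4)] carrier_matD[OF T] in \<open>simp del: index_mult_mat assoc_mult_mat\<close>)+
qed

text \<open>Column \<open>j\<close> is the image of the \<open>j\<close>-th unit vector, and
  multiplying \<open>M\<close> by that vector returns column \<open>j\<close> of
  \<open>M\<close>.\<close>

lemma representation_matrix_eqI:
  assumes M: "M \<in> carrier_mat K K"
    and H: "\<And>v. v \<in> carrier_vec K \<Longrightarrow> H v = M *\<^sub>v v"
  shows "representation_matrix K H = M"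
proof (rule eq_matI)
  fix i j assume "i < dim_row M" "j < dim_col M"
  then have ij: "i < K" "j < K" using M by auto
  then have "representation_matrix K H $$ (i, j) = (M *\<^sub>v unit_vec K j) $ i"
    by (simp add: representation_matrix_def mat_of_cols_def H)
  also have "\<dots> = M $$ (i, j)" using M ij by (simp add: scalar_prod_right_unit)
  finally show "representation_matrix K H $$ (i, j) = M $$ (i, j)" .
qed (use M in \<open>auto simp: representation_matrix_def\<close>)

section \<open>The block matrix evaluated on coordinate vectors\<close>

theorem proposition3p2:
  fixes p n N K :: nat
    and A Z Zp Zpp :: "nat \<Rightarrow> real mat"
    and Y Yp :: "real mat"
    and B_H C_H :: "real mat \<Rightarrow> real mat \<Rightarrow> real mat"
    and H :: "real vec \<Rightarrow> real vec"
    and H11 H12 H21 H22 :: "real mat"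
  assumes p: "1 \<le> p" "p \<le> n"
    and A: "\<And>l. l \<in> {1..N} \<Longrightarrow> A l \<in> carrier_mat n n \<and> (A l)\<^sup>T = A l"
    and Y: "Y \<in> stiefel p n"
    and Yp: "Yp \<in> carrier_mat n (n - p)" "Y\<^sup>T * Yp = 0\<^sub>m p (n - p)" "Yp\<^sup>T * Yp = 1\<^sub>m (n - p)"
  defines "Z \<equiv> \<lambda>l. Y\<^sup>T * A l * Y"
    and "Zp \<equiv> \<lambda>l. Y\<^sup>T * A l * Yp"
    and "Zpp \<equiv> \<lambda>l. Yp\<^sup>T * A l * Yp"
    and "K \<equiv> p * (p - 1) div 2 + p * (n - p)"
    and "B_H \<equiv> \<lambda>B C. (-4) \<cdot>\<^sub>m msum p p
          (\<lambda>l. skew_part ((Z l * B + Zp l * C) * diag_part (Z l)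
                 + 2 \<cdot>\<^sub>m (Z l * diag_part (Z l * B + Zp l * C))
                 - B * sym_part (Z l * diag_part (Z l)))) {1..N}"
    and "C_H \<equiv> \<lambda>B C. (-4) \<cdot>\<^sub>m msum (n - p) p
          (\<lambda>l. ((Zp l)\<^sup>T * B + Zpp l * C) * diag_part (Z l)
                 + 2 \<cdot>\<^sub>m ((Zp l)\<^sup>T * diag_part (Z l * B + Zp l * C))
                 - C * sym_part (Z l * diag_part (Z l))) {1..N}"
  assumes lin: "linear_on K H"
    and act: "\<And>B C. B \<in> Skew p \<Longrightarrow> C \<in> carrier_mat (n - p) p \<Longrightarrow>
          H (veck B @\<^sub>v vec_op C) = veck (B_H B C) @\<^sub>v vec_op (C_H B C)"
  defines "H11 \<equiv> (-2) \<cdot>\<^sub>m ((D_mat p)\<^sup>T * msum (p * p) (p * p)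
          (\<lambda>l. diag_part (Z l) \<otimes>\<^sub>K Z l
                 + 2 \<cdot>\<^sub>m ((1\<^sub>m p \<otimes>\<^sub>K Z l) * Delta_mat p * (1\<^sub>m p \<otimes>\<^sub>K Z l))
                 - sym_part (Z l * diag_part (Z l)) \<otimes>\<^sub>K 1\<^sub>m p) {1..N} * D_mat p)"
    and "H12 \<equiv> (-2) \<cdot>\<^sub>m ((D_mat p)\<^sup>T * msum (p * p) (p * (n - p))
          (\<lambda>l. diag_part (Z l) \<otimes>\<^sub>K Zp l
                 + 2 \<cdot>\<^sub>m ((1\<^sub>m p \<otimes>\<^sub>K Z l) * Delta_mat p * (1\<^sub>m p \<otimes>\<^sub>K Zp l))) {1..N})"
    and "H21 \<equiv> (-4) \<cdot>\<^sub>m (msum (p * (n - p)) (p * p)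
          (\<lambda>l. diag_part (Z l) \<otimes>\<^sub>K (Zp l)\<^sup>T
                 + 2 \<cdot>\<^sub>m ((1\<^sub>m p \<otimes>\<^sub>K (Zp l)\<^sup>T) * Delta_mat p * (1\<^sub>m p \<otimes>\<^sub>K Z l))) {1..N} * D_mat p)"
    and "H22 \<equiv> (-4) \<cdot>\<^sub>m msum (p * (n - p)) (p * (n - p))
          (\<lambda>l. diag_part (Z l) \<otimes>\<^sub>K Zpp l
                 + 2 \<cdot>\<^sub>m ((1\<^sub>m p \<otimes>\<^sub>K (Zp l)\<^sup>T) * Delta_mat p * (1\<^sub>m p \<otimes>\<^sub>K Zp l))
                 - sym_part (Z l * diag_part (Z l)) \<otimes>\<^sub>K 1\<^sub>m (n - p)) {1..N}"
  shows "representation_matrix K H = four_block_mat H11 H12 H21 H22"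
proof -
  \<comment> \<open>The value \<open>q = 0\<close> is included: blocks and vectors then have empty
    parts, and the case \<open>p = n\<close> needs no separate argument.\<close>
  define q where "q = n - p"
  let ?d = "p * (p - 1) div 2"
  let ?I = "{1..N}"
  have YC: "Y \<in> carrier_mat n p" using Y by (simp add: stiefel_def)
  have YpC: "Yp \<in> carrier_mat n q" using Yp by (simp add: q_def)
  have Zc: "Z l \<in> carrier_mat p p" "Zp l \<in> carrier_mat p q" "Zpp l \<in> carrier_mat q q"
    if "l \<in> ?I" for l
    unfolding Z_def Zp_def Zpp_def
    using A[OF that] YC YpC by (meson mult_carrier_mat transpose_carrier_mat)+
  define S where "S l = sym_part (Z l * diag_part (Z l))" for l
  \<comment> \<open>The symmetry facts \<open>St\<close> and \<open>dt\<close> remove the transposes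
    that the Kronecker rule leaves on the right-hand factors.\<close>
  have Sc: "S l \<in> carrier_mat p p" and St: "(S l)\<^sup>T = S l"
    and dc: "diag_part (Z l) \<in> carrier_mat p p" and dt: "(diag_part (Z l))\<^sup>T = diag_part (Z l)"
    if "l \<in> ?I" for l
    using Zc(1)[OF that] unfolding S_def
    by (auto intro!: transpose_sym_part[of _ p] transpose_diag_part[of _ p] sym_part_carrier
        diag_part_carrier mult_carrier_mat)
  \<comment> \<open>The \<open>F\<close> matrices are the summands of the four blocks, and the
    \<open>M\<close> matrices below are their sums, without the outer scalars and
    \<open>D_mat\<close>.\<close>
  define F11 where "F11 l = diag_part (Z l) \<otimes>\<^sub>K Z l
    + 2 \<cdot>\<^sub>m ((1\<^sub>m p \<otimes>\<^sub>K Z l) * Delta_mat p * (1\<^sub>m p \<otimes>\<^sub>K Z l)) - S l \<otimes>\<^sub>K 1\<^sub>m p" for l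
  define F12 where "F12 l = diag_part (Z l) \<otimes>\<^sub>K Zp l
    + 2 \<cdot>\<^sub>m ((1\<^sub>m p \<otimes>\<^sub>K Z l) * Delta_mat p * (1\<^sub>m p \<otimes>\<^sub>K Zp l))" for l
  define F21 where "F21 l = diag_part (Z l) \<otimes>\<^sub>K (Zp l)\<^sup>T
    + 2 \<cdot>\<^sub>m ((1\<^sub>m p \<otimes>\<^sub>K (Zp l)\<^sup>T) * Delta_mat p * (1\<^sub>m p \<otimes>\<^sub>K Z l))" for l
  define F22 where "F22 l = diag_part (Z l) \<otimes>\<^sub>K Zpp l
    + 2 \<cdot>\<^sub>m ((1\<^sub>m p \<otimes>\<^sub>K (Zp l)\<^sup>T) * Delta_mat p * (1\<^sub>m p \<otimes>\<^sub>K Zp l)) - S l \<otimes>\<^sub>K 1\<^sub>m q" for l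
  have Fc: "F11 l \<in> carrier_mat (p * p) (p * p)" "F12 l \<in> carrier_mat (p * p) (p * q)"
    "F21 l \<in> carrier_mat (p * q) (p * p)" "F22 l \<in> carrier_mat (p * q) (p * q)"
    if "l \<in> ?I" for l
  proof -
    have "1\<^sub>m p \<otimes>\<^sub>K Z l \<in> carrier_mat (p * p) (p * p)" "1\<^sub>m p \<otimes>\<^sub>K Zp l \<in> carrier_mat (p * p) (p * q)"
      "1\<^sub>m p \<otimes>\<^sub>K (Zp l)\<^sup>T \<in> carrier_mat (p * q) (p * p)"
      "S l \<otimes>\<^sub>K 1\<^sub>m p \<in> carrier_mat (p * p) (p * p)" "S l \<otimes>\<^sub>K 1\<^sub>m q \<in> carrier_mat (p * q) (p * q)"
      using Zc[OF that] Sc[OF that] by auto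
    then show "F11 l \<in> carrier_mat (p * p) (p * p)" "F12 l \<in> carrier_mat (p * p) (p * q)"
      "F21 l \<in> carrier_mat (p * q) (p * p)" "F22 l \<in> carrier_mat (p * q) (p * q)"
      unfolding F11_def F12_def F21_def F22_def
      by (meson add_carrier_mat smult_carrier_mat mult_carrier_mat minus_carrier_mat
          Delta_mat_carrier)+
  qed
  define M11 M12 M21 M22 where "M11 = msum (p * p) (p * p) F11 ?I"
    and "M12 = msum (p * p) (p * q) F12 ?I"
    and "M21 = msum (p * q) (p * p) F21 ?I"
    and "M22 = msum (p * q) (p * q) F22 ?I"
  have Mc: "M11 \<in> carrier_mat (p * p) (p * p)" "M12 \<in> carrier_mat (p * p) (p * q)"
    "M21 \<in> carrier_mat (p * q) (p * p)" "M22 \<in> carrier_mat (p * q) (p * q)"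
    unfolding M11_def M12_def M21_def M22_def by (rule msum_carrier, erule Fc)+
  let ?D = "D_mat p"
  have Dc: "?D \<in> carrier_mat (p * p) ?d" by (rule D_mat_carrier)
  then have Dt: "?D\<^sup>T \<in> carrier_mat ?d (p * p)" by simp
  have H_eq: "H11 = (-2) \<cdot>\<^sub>m (?D\<^sup>T * M11 * ?D)" "H12 = (-2) \<cdot>\<^sub>m (?D\<^sup>T * M12)"
    "H21 = (-4) \<cdot>\<^sub>m (M21 * ?D)" "H22 = (-4) \<cdot>\<^sub>m M22"
    unfolding H11_def H12_def H21_def H22_def M11_def M12_def M21_def M22_def
      F11_def[abs_def] F12_def[abs_def] F21_def[abs_def] F22_def[abs_def] S_def q_def
    by (rule refl)+
  have Hc: "H11 \<in> carrier_mat ?d ?d" "H12 \<in> carrier_mat ?d (p * q)"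
    "H21 \<in> carrier_mat (p * q) ?d" "H22 \<in> carrier_mat (p * q) (p * q)"
    unfolding H_eq by (meson smult_carrier_mat mult_carrier_mat Dc Dt Mc)+
  have K: "K = ?d + p * q" by (simp add: K_def q_def)
  have block: "four_block_mat H11 H12 H21 H22 *\<^sub>v (veck B @\<^sub>v vec_op C)
    = veck (B_H B C) @\<^sub>v vec_op (C_H B C)" if B: "B \<in> Skew p" and C: "C \<in> carrier_mat q p" for B C
  proof -
    have Bc: "B \<in> carrier_mat p p" using B by (simp add: Skew_def)
    \<comment> \<open>The first index names the output, \<open>B_H\<close> or \<open>C_H\<close>,
      the second the input, \<open>B\<close> or \<open>C\<close>. These are the matrices whose
      vectorizations the \<open>F\<close> matrices produce.\<close>
    define W11 where "W11 l = Z l * B * diag_part (Z l) + 2 \<cdot>\<^sub>m (Z l * diag_part (Z l * B)) - B * S l" for l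
    define W12 where "W12 l = Zp l * C * diag_part (Z l) + 2 \<cdot>\<^sub>m (Z l * diag_part (Zp l * C))" for l
    define W21 where "W21 l = (Zp l)\<^sup>T * B * diag_part (Z l) + 2 \<cdot>\<^sub>m ((Zp l)\<^sup>T * diag_part (Z l * B))" for l
    define W22 where "W22 l = Zpp l * C * diag_part (Z l) + 2 \<cdot>\<^sub>m ((Zp l)\<^sup>T * diag_part (Zp l * C)) - C * S l" for l
    have Wc: "W11 l \<in> carrier_mat p p" "W12 l \<in> carrier_mat p p"
      "W21 l \<in> carrier_mat q p" "W22 l \<in> carrier_mat q p" if "l \<in> ?I" for l
      unfolding W11_def W12_def W21_def W22_def
      using Zc[OF that] Sc[OF that] Bc C
      by (meson add_carrier_mat smult_carrier_mat mult_carrier_mat minus_carrier_mat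
          diag_part_carrier transpose_carrier_mat)+
    have FW: "F11 l *\<^sub>v vec_op B = vec_op (W11 l)" "F12 l *\<^sub>v vec_op C = vec_op (W12 l)"
      "F21 l *\<^sub>v vec_op B = vec_op (W21 l)" "F22 l *\<^sub>v vec_op C = vec_op (W22 l)"
      if l: "l \<in> ?I" for l
    proof -
      note Zl = Zc[OF l]
      have ZpT: "(Zp l)\<^sup>T \<in> carrier_mat q p" using Zl(2) by simp
      show "F11 l *\<^sub>v vec_op B = vec_op (W11 l)"
        using kronecker_Delta_minus_mult_vec_op[OF dc[OF l] Zl(1) Zl(1) Zl(1) Bc Sc[OF l]]
        by (simp only: F11_def W11_def St[OF l] dt[OF l])
      show "F12 l *\<^sub>v vec_op C = vec_op (W12 l)"
        using kronecker_Delta_mult_vec_op[OF dc[OF l] Zl(2) Zl(1) Zl(2) C]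
        by (simp only: F12_def W12_def dt[OF l])
      show "F21 l *\<^sub>v vec_op B = vec_op (W21 l)"
        using kronecker_Delta_mult_vec_op[OF dc[OF l] ZpT ZpT Zl(1) Bc]
        by (simp only: F21_def W21_def dt[OF l])
      show "F22 l *\<^sub>v vec_op C = vec_op (W22 l)"
        using kronecker_Delta_minus_mult_vec_op[OF dc[OF l] Zl(3) ZpT Zl(2) C Sc[OF l]]
        by (simp only: F22_def W22_def St[OF l] dt[OF l])
    qed
    define U11 U12 U21 U22 where "U11 = msum p p W11 ?I" and "U12 = msum p p W12 ?I"
      and "U21 = msum q p W21 ?I" and "U22 = msum q p W22 ?I"
    have Uc: "U11 \<in> carrier_mat p p" "U12 \<in> carrier_mat p p"
      "U21 \<in> carrier_mat q p" "U22 \<in> carrier_mat q p"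
      unfolding U11_def U12_def U21_def U22_def by (rule msum_carrier, erule Wc)+
    have vB: "vec_op B \<in> carrier_vec (p * p)" and vC: "vec_op C \<in> carrier_vec (p * q)"
      using Bc C by simp_all
    have kB: "veck B \<in> carrier_vec ?d" using Bc by (rule veck_carrier)
    have MU: "M11 *\<^sub>v vec_op B = vec_op U11" "M12 *\<^sub>v vec_op C = vec_op U12"
      "M21 *\<^sub>v vec_op B = vec_op U21" "M22 *\<^sub>v vec_op C = vec_op U22"
      unfolding M11_def M12_def M21_def M22_def U11_def U12_def U21_def U22_def
      by (rule msum_mult_vec_op; use vB vC Fc Wc FW in \<open>simp del: carrier_vec_dim_vec\<close>)+
    have sumB: "msum p p (\<lambda>l. skew_part ((Z l * B + Zp l * C) * diag_part (Z l)
        + 2 \<cdot>\<^sub>m (Z l * diag_part (Z l * B + Zp l * C)) - B * S l)) ?I = skew_part (U11 + U12)"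
    proof -
      have "U11 + U12 = msum p p (\<lambda>l. W11 l + W12 l) ?I"
        unfolding U11_def U12_def by (rule msum_add[OF finite_atLeastAtMost]) (erule Wc)+
      then have "skew_part (U11 + U12) = skew_part (msum p p (\<lambda>l. W11 l + W12 l) ?I)"
        by (rule arg_cong)
      also have "\<dots> = msum p p (\<lambda>l. skew_part (W11 l + W12 l)) ?I"
        by (rule skew_part_msum[OF finite_atLeastAtMost]) (rule add_carrier_mat, erule Wc)
      also have "\<dots> = msum p p (\<lambda>l. skew_part ((Z l * B + Zp l * C) * diag_part (Z l)
        + 2 \<cdot>\<^sub>m (Z l * diag_part (Z l * B + Zp l * C)) - B * S l)) ?I"
      proof (rule msum_cong)
        fix l assume l: "l \<in> ?I"
        note Zl = Zc[OF l]
        show "skew_part (W11 l + W12 l) \<in> carrier_mat p p"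
          using Wc(1,2)[OF l] by simp
        show "skew_part (W11 l + W12 l) = skew_part ((Z l * B + Zp l * C) * diag_part (Z l)
          + 2 \<cdot>\<^sub>m (Z l * diag_part (Z l * B + Zp l * C)) - B * S l)"
          unfolding W11_def W12_def
          by (rule arg_cong[OF summand_split(1)[OF Zl(1,2) Bc C dc[OF l] Zl(1) Zl(1,2)
                  mult_carrier_mat[OF Bc Sc[OF l]]]])
      qed
      finally show ?thesis ..
    qed
    have sumC: "msum q p (\<lambda>l. ((Zp l)\<^sup>T * B + Zpp l * C) * diag_part (Z l)
        + 2 \<cdot>\<^sub>m ((Zp l)\<^sup>T * diag_part (Z l * B + Zp l * C)) - C * S l) ?I = U21 + U22"
    proof -
      have "U21 + U22 = msum q p (\<lambda>l. W21 l + W22 l) ?I"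
        unfolding U21_def U22_def by (rule msum_add[OF finite_atLeastAtMost]) (erule Wc)+
      also have "\<dots> = msum q p (\<lambda>l. ((Zp l)\<^sup>T * B + Zpp l * C) * diag_part (Z l)
        + 2 \<cdot>\<^sub>m ((Zp l)\<^sup>T * diag_part (Z l * B + Zp l * C)) - C * S l) ?I"
      proof (rule msum_cong)
        fix l assume l: "l \<in> ?I"
        note Zl = Zc[OF l]
        have ZpT: "(Zp l)\<^sup>T \<in> carrier_mat q p" using Zl(2) by simp
        show "W21 l + W22 l \<in> carrier_mat q p"
          using Wc(3,4)[OF l] by simp
        \<comment> \<open>The second grouping applies, because \<open>C * S l\<close> is part of
          \<open>W22\<close>; for \<open>B_H\<close> the term \<open>B * S l\<close> was part of
          \<open>W11\<close>.\<close>
        show "W21 l + W22 l = ((Zp l)\<^sup>T * B + Zpp l * C) * diag_part (Z l)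
          + 2 \<cdot>\<^sub>m ((Zp l)\<^sup>T * diag_part (Z l * B + Zp l * C)) - C * S l"
          unfolding W21_def W22_def
          by (rule summand_split(2)[OF ZpT Zl(3) Bc C dc[OF l] ZpT Zl(1,2)
                mult_carrier_mat[OF C Sc[OF l]]])
      qed
      finally show ?thesis ..
    qed
    have BH: "B_H B C = (-4) \<cdot>\<^sub>m skew_part (U11 + U12)"
      unfolding B_H_def sumB[unfolded S_def] ..
    have CH: "C_H B C = (-4) \<cdot>\<^sub>m (U21 + U22)"
      unfolding C_H_def sumC[unfolded S_def q_def] ..
    have "H11 *\<^sub>v veck B = (-2) \<cdot>\<^sub>v (?D\<^sup>T * M11 * ?D *\<^sub>v veck B)"
      unfolding H_eq by (rule smult_mult_mat_vec[OF mult_carrier_mat[OF mult_carrier_mat[OF Dt Mc(1)] Dc] kB])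
    also have "?D\<^sup>T * M11 * ?D *\<^sub>v veck B = ?D\<^sup>T * M11 *\<^sub>v (?D *\<^sub>v veck B)"
      by (rule assoc_mult_mat_vec[OF mult_carrier_mat[OF Dt Mc(1)] Dc kB])
    also have "?D *\<^sub>v veck B = vec_op B" by (rule D_mat_mult_veck[OF B])
    also have "?D\<^sup>T * M11 *\<^sub>v vec_op B = ?D\<^sup>T *\<^sub>v vec_op U11"
      using assoc_mult_mat_vec[OF Dt Mc(1) vB] by (simp only: MU)
    finally have h11: "H11 *\<^sub>v veck B = (-2) \<cdot>\<^sub>v (?D\<^sup>T *\<^sub>v vec_op U11)" .
    have "H12 *\<^sub>v vec_op C = (-2) \<cdot>\<^sub>v (?D\<^sup>T * M12 *\<^sub>v vec_op C)"
      unfolding H_eq by (rule smult_mult_mat_vec[OF mult_carrier_mat[OF Dt Mc(2)] vC])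
    also have "?D\<^sup>T * M12 *\<^sub>v vec_op C = ?D\<^sup>T *\<^sub>v vec_op U12"
      using assoc_mult_mat_vec[OF Dt Mc(2) vC] by (simp only: MU)
    finally have h12: "H12 *\<^sub>v vec_op C = (-2) \<cdot>\<^sub>v (?D\<^sup>T *\<^sub>v vec_op U12)" .
    have "H21 *\<^sub>v veck B = (-4) \<cdot>\<^sub>v (M21 * ?D *\<^sub>v veck B)"
      unfolding H_eq by (rule smult_mult_mat_vec[OF mult_carrier_mat[OF Mc(3) Dc] kB])
    also have "M21 * ?D *\<^sub>v veck B = vec_op U21"
      using assoc_mult_mat_vec[OF Mc(3) Dc kB] by (simp only: D_mat_mult_veck[OF B] MU)
    finally have h21: "H21 *\<^sub>v veck B = (-4) \<cdot>\<^sub>v vec_op U21" .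
    have h22: "H22 *\<^sub>v vec_op C = (-4) \<cdot>\<^sub>v vec_op U22"
      unfolding H_eq using smult_mult_mat_vec[OF Mc(4) vC] by (simp only: MU)
    have vU: "vec_op U11 \<in> carrier_vec (p * p)" "vec_op U12 \<in> carrier_vec (p * p)"
      using Uc by simp_all
    have U: "U11 + U12 \<in> carrier_mat p p" using Uc by simp
    \<comment> \<open>Both products end in the transpose of \<open>D_mat\<close>, so it can act once
      on the sum, as the skew part of \<open>U11 + U12\<close> requires.\<close>
    have "H11 *\<^sub>v veck B + H12 *\<^sub>v vec_op C = (-2) \<cdot>\<^sub>v (?D\<^sup>T *\<^sub>v vec_op (U11 + U12))"
      unfolding h11 h12 vec_op_add[OF Uc(1,2)] mult_add_distrib_mat_vec[OF Dt vU]
      by (rule smult_add_distrib_vec[symmetric]; rule mult_mat_vec_carrier[OF Dt]) (fact vU)+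
    \<comment> \<open>The scalar -2 meets the factor 2 from
      \<open>transpose_D_mat_mult_vec_op\<close>.\<close>
    also have "\<dots> = (-4) \<cdot>\<^sub>v veck (skew_part (U11 + U12))"
      by (simp add: transpose_D_mat_mult_vec_op[OF U] smult_smult_assoc)
    also have "\<dots> = veck (B_H B C)"
      unfolding BH by (rule veck_smult[OF skew_part_carrier[OF U], symmetric])
    finally have top: "H11 *\<^sub>v veck B + H12 *\<^sub>v vec_op C = veck (B_H B C)" .
    have "H21 *\<^sub>v veck B + H22 *\<^sub>v vec_op C = vec_op (C_H B C)"
      unfolding h21 h22 CH vec_op_smult vec_op_add[OF Uc(3,4)]
      by (rule smult_add_distrib_vec[symmetric, of _ "p * q"]) (use Uc in simp_all)
    with top show ?thesis
      by (simp only: four_block_mat_mult_vec[OF Hc kB vC])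
  qed
  show ?thesis
  proof (rule representation_matrix_eqI)
    show "four_block_mat H11 H12 H21 H22 \<in> carrier_mat K K"
      unfolding K by (rule four_block_carrier_mat[OF Hc(1,4)])
    fix v :: "real vec" assume "v \<in> carrier_vec K"
    \<comment> \<open>Surjectivity of the coordinate map supplies \<open>B\<close> and
      \<open>C\<close> for an arbitrary \<open>v\<close>, where \<open>act\<close> and
      \<open>block\<close> give the same value.\<close>
    then have "v \<in> (\<lambda>(B, C). veck B @\<^sub>v vec_op C) ` (Skew p \<times> carrier_mat q p)"
      using bij_betw_imp_surj_on[OF bij_betw_coords[of p q]] by (simp only: K)
    then obtain B C where "B \<in> Skew p" "C \<in> carrier_mat q p" "v = veck B @\<^sub>v vec_op C" by auto
    then show "H v = four_block_mat H11 H12 H21 H22 *\<^sub>v v"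
      using act[of B C] block[of B C] by (simp add: q_def)
  qed
qed

end
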